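(* Let $H=(h_{ik})$ be the adjacency matrix of a graph on $m$ vertices, $t_0\in\mathbb{R}$, $B\in\mathcal{M}^+$ and $V\in\mathcal{M}$. Then the maximal solution $Z_H(t,B,V)$ of the initial value problem $X'=Y$, $Y'=F_H(X)$, $X(t_0)=B$, $Y(t_0)=V$ is defined on the whole interval $(-\infty,+\infty)$.
   Context: $\mathcal{M}$ is the set of real $m\times m$ matrices and $\mathcal{M}^+\subset\mathcal{M}$ the set of those with pairwise distinct rows. For $X\in\mathcal{M}^+$ with rows $x_1,\dots,x_m$ (Euclidean norm $\|\cdot\|$), $F_H(X)\in\mathcal{M}$ is given by $F_H(X)_{ij}=\sum_{k\neq i}(x_{ij}-x_{kj})\left(\frac{1}{\|x_i-x_k\|^2}-h_{ik}\right)$. The phase space is $\mathcal{M}^+\times\mathcal{M}$, and $Z_H(t,B,V)=(X_H(t,B,V),Y_H(t,B,V))$ denotes the unique solution extended to its maximal open interval of existence. *)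

theory Defs
  imports "HOL-Analysis.Analysis"
begin

text \<open>The vertex set of the graph is the finite index type \<open>'m\<close>, so \<open>m = CARD('m)\<close>.
  A simple undirected graph is given by its set of edges, which are two-element sets of vertices.\<close>

definition simple_graph :: "'m set set \<Rightarrow> bool" where
  "simple_graph E \<longleftrightarrow> (\<forall>e\<in>E. card e = 2)"

definition adjacency_matrix :: "'m::finite set set \<Rightarrow> real^'m^'m" where
  "adjacency_matrix E = (\<chi> i k. if {i, k} \<in> E then 1 else 0)"

definition distinct_rows :: "(real^'m^'m) set" where
  "distinct_rows = {X. \<forall>i k. i \<noteq> k \<longrightarrow> X $ i \<noteq> X $ k}"

definition force :: "real^'m^'m \<Rightarrow> real^'m^'m \<Rightarrow> real^'m^'m" where
  "force H X = (\<chi> i j. \<Sum>k\<in>UNIV - {i}.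
     (X $ i $ j - X $ k $ j) * (1 / (norm (X $ i - X $ k))\<^sup>2 - H $ i $ k))"

definition solves_ivp ::
  "real^'m^'m \<Rightarrow> real \<Rightarrow> real^'m^'m \<Rightarrow> real^'m^'m \<Rightarrow> real set \<Rightarrow>
     (real \<Rightarrow> (real^'m^'m) \<times> (real^'m^'m)) \<Rightarrow> bool" where
  "solves_ivp H t\<^sub>0 B V I Z \<longleftrightarrow>
     open I \<and> is_interval I \<and> t\<^sub>0 \<in> I \<and> Z t\<^sub>0 = (B, V) \<and>
     (\<forall>t\<in>I. Z t \<in> distinct_rows \<times> UNIV \<and>
        ((\<lambda>s. fst (Z s)) has_vector_derivative snd (Z t)) (at t) \<and>
        ((\<lambda>s. snd (Z s)) has_vector_derivative force H (fst (Z t))) (at t))"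

text \<open>Since solutions are unique, the maximal open interval of existence is the union of the
  intervals on which a solution exists, and the value at \<open>t\<close> of the maximal solution is the
  common value at \<open>t\<close> of all solutions whose interval contains \<open>t\<close>. Outside the
  interval of existence the value of \<open>maximal_solution\<close> is unspecified.\<close>

definition existence_interval ::
  "real^'m^'m \<Rightarrow> real \<Rightarrow> real^'m^'m \<Rightarrow> real^'m^'m \<Rightarrow> real set" where
  "existence_interval H t\<^sub>0 B V = \<Union>{I. \<exists>Z. solves_ivp H t\<^sub>0 B V I Z}"

definition maximal_solution ::
  "real^'m^'m \<Rightarrow> real \<Rightarrow> real^'m^'m \<Rightarrow> real^'m^'m \<Rightarrow>
     real \<Rightarrow> (real^'m^'m) \<times> (real^'m^'m)" where
  "maximal_solution H t\<^sub>0 B V t =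
     (THE z. \<exists>I Z. solves_ivp H t\<^sub>0 B V I Z \<and> t \<in> I \<and> z = Z t)"

end

theory Submission
  imports Defs
begin

text \<open>Replacing \<open>1 / r\<^sup>2\<close> by \<open>1 / max (r\<^sup>2) \<delta>\<close> makes the vector field globally Lipschitz,
  so the modified system has global solutions. It still conserves an energy, in which the logarithm
  is continued below \<open>\<delta>\<close> by its tangent line. Since \<open>ln s \<le> s\<close>, conservation gives
  \<open>\<parallel>Y\<parallel>\<^sup>2 \<le> C + C * \<parallel>X\<parallel>\<^sup>2\<close>, and Gronwall's inequality bounds \<open>X\<close> on \<open>[t\<^sub>0 - T, t\<^sub>0 + T]\<close>
  independently of \<open>\<delta>\<close>. Two rows at distance less than \<open>\<surd>\<delta>\<close> would contribute a term at most
  \<open>ln \<delta>\<close> to the energy balance, which is impossible once \<open>\<delta>\<close> is small; so for that \<open>\<delta>\<close> the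
  modified solution solves the original system on \<open>[t\<^sub>0 - T, t\<^sub>0 + T]\<close>.\<close>

subsection \<open>Globally Lipschitz differential equations\<close>

text \<open>The weight \<open>exp (- c * s)\<close> to the right of \<open>a\<close> and
  \<open>exp (c * s)\<close> to the left of it make the product with \<open>u\<close> monotone. The
  upper bound on \<open>u'\<close> serves the first case, the lower bound the second.\<close>

lemma gronwall_abs:
  fixes u :: "real \<Rightarrow> real"
  assumes "is_interval I" "a \<in> I" "t \<in> I"
    and du: "\<And>s. s \<in> I \<Longrightarrow> (u has_real_derivative u' s) (at s)"
    and bound: "\<And>s. s \<in> I \<Longrightarrow> \<bar>u' s\<bar> \<le> c * u s"
  shows "u t \<le> u a * exp (c * \<bar>t - a\<bar>)"
proof (cases "a \<le> t")
  case True
  have sub: "s \<in> I" if "a \<le> s" "s \<le> t" for s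
    using mem_is_interval_1_I[OF assms(1-3)] that by blast
  have "u t * exp (- c * t) \<le> u a * exp (- c * a)"
  proof (rule DERIV_nonpos_imp_nonincreasing[OF True], intro exI conjI)
    fix s assume s: "a \<le> s" "s \<le> t"
    have e: "((\<lambda>s. exp (- c * s)) has_real_derivative - c * exp (- c * s)) (at s)"
      using DERIV_fun_exp[OF DERIV_cmult_Id[of "- c" s]] by (simp only: mult.commute)
    show "((\<lambda>s. u s * exp (- c * s)) has_real_derivative (u' s - c * u s) * exp (- c * s)) (at s)"
      by (rule DERIV_cong[OF DERIV_mult[OF du[OF sub[OF s]] e]]) (simp add: algebra_simps)
    show "(u' s - c * u s) * exp (- c * s) \<le> 0"
      using bound[OF sub[OF s]] by (intro mult_nonpos_nonneg exp_ge_zero) linarith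
  qed
  hence "u t * exp (- c * t) * exp (c * t) \<le> u a * exp (- c * a) * exp (c * t)"
    by (rule mult_right_mono) simp
  moreover have "c * \<bar>t - a\<bar> = - c * a + c * t" using True by (simp add: algebra_simps)
  ultimately show ?thesis by (simp only: mult.assoc exp_add [symmetric]) simp
next
  case False
  hence le: "t \<le> a" by simp
  have sub: "s \<in> I" if "t \<le> s" "s \<le> a" for s
    using mem_is_interval_1_I[OF assms(1,3,2)] that by blast
  have "u t * exp (c * t) \<le> u a * exp (c * a)"
  proof (rule DERIV_nonneg_imp_nondecreasing[OF le], intro exI conjI)
    fix s assume s: "t \<le> s" "s \<le> a"
    have e: "((\<lambda>s. exp (c * s)) has_real_derivative c * exp (c * s)) (at s)"
      using DERIV_fun_exp[OF DERIV_cmult_Id[of "c" s]] by (simp only: mult.commute)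
    show "((\<lambda>s. u s * exp (c * s)) has_real_derivative (u' s + c * u s) * exp (c * s)) (at s)"
      by (rule DERIV_cong[OF DERIV_mult[OF du[OF sub[OF s]] e]]) (simp add: algebra_simps)
    show "0 \<le> (u' s + c * u s) * exp (c * s)"
      using bound[OF sub[OF s]] by (intro mult_nonneg_nonneg exp_ge_zero) linarith
  qed
  hence "u t * exp (c * t) * exp (- c * t) \<le> u a * exp (c * a) * exp (- c * t)"
    by (rule mult_right_mono) simp
  moreover have "c * \<bar>t - a\<bar> = c * a + - c * t" using le by (simp add: algebra_simps)
  ultimately show ?thesis by (simp only: mult.assoc exp_add [symmetric]) simp
qed

lemma has_real_derivative_inner:
  fixes f g :: "real \<Rightarrow> 'a::real_inner"
  assumes "(f has_vector_derivative f') (at t)" "(g has_vector_derivative g') (at t)"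
  shows "((\<lambda>s. f s \<bullet> g s) has_real_derivative f t \<bullet> g' + f' \<bullet> g t) (at t)"
proof -
  have "((\<lambda>s. f s \<bullet> g s) has_derivative (\<lambda>h. f t \<bullet> (h *\<^sub>R g') + (h *\<^sub>R f') \<bullet> g t)) (at t)"
    using assms unfolding has_vector_derivative_def by (rule has_derivative_inner)
  moreover have "(\<lambda>h. f t \<bullet> (h *\<^sub>R g') + (h *\<^sub>R f') \<bullet> g t) = (*) (f t \<bullet> g' + f' \<bullet> g t)"
    by (simp add: fun_eq_iff algebra_simps)
  ultimately show ?thesis by (simp add: has_field_derivative_def)
qed

text \<open>Gronwall's inequality for the squared distance of the two solutions, which is 0 at
  \<open>a\<close>. Cauchy-Schwarz and the Lipschitz bound give the rate \<open>2 * L\<close> in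
  both time directions.\<close>

lemma lipschitz_ode_unique:
  fixes f :: "'a::real_inner \<Rightarrow> 'a"
  assumes lip: "L-lipschitz_on UNIV f"
    and I: "is_interval I" "a \<in> I" "t \<in> I"
    and x: "\<And>s. s \<in> I \<Longrightarrow> (x has_vector_derivative f (x s)) (at s)"
    and y: "\<And>s. s \<in> I \<Longrightarrow> (y has_vector_derivative f (y s)) (at s)"
    and "x a = y a"
  shows "x t = y t"
proof -
  define u where "u s = (x s - y s) \<bullet> (x s - y s)" for s
  have "u t \<le> u a * exp (2 * L * \<bar>t - a\<bar>)"
  proof (rule gronwall_abs[OF I])
    fix s assume s: "s \<in> I"
    have d: "((\<lambda>s. x s - y s) has_vector_derivative (f (x s) - f (y s))) (at s)"
      by (intro has_vector_derivative_diff x y s)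
    show "(u has_real_derivative 2 * ((x s - y s) \<bullet> (f (x s) - f (y s)))) (at s)"
      using has_real_derivative_inner[OF d d] by (simp add: u_def[abs_def] inner_commute)
    have "\<bar>(x s - y s) \<bullet> (f (x s) - f (y s))\<bar> \<le> norm (x s - y s) * norm (f (x s) - f (y s))"
      by (rule Cauchy_Schwarz_ineq2)
    also have "\<dots> \<le> norm (x s - y s) * (L * norm (x s - y s))"
      using lipschitz_on_normD[OF lip] by (intro mult_left_mono) auto
    finally show "\<bar>2 * ((x s - y s) \<bullet> (f (x s) - f (y s)))\<bar> \<le> 2 * L * u s"
      by (simp add: u_def dot_square_norm power2_eq_square algebra_simps)
  qed
  thus ?thesis using \<open>x a = y a\<close> inner_ge_zero[of "x t - y t"] by (simp add: u_def)
qed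

section \<open>Global existence by a weighted Picard iteration\<close>

lemma continuous_on_antiderivative:
  fixes g :: "real \<Rightarrow> 'a::banach"
  assumes "continuous_on UNIV g"
  shows "\<exists>G. G 0 = 0 \<and> (\<forall>t. (G has_vector_derivative g t) (at t))"
proof -
  define G where "G t = (if 0 \<le> t then integral {0..t} g else - integral {t..0} g)" for t
  have int: "g integrable_on {a..b}" for a b
    using assms by (intro integrable_continuous_real continuous_on_subset[OF assms]) auto
  \<comment> \<open>Seen from a base point \<open>a\<close> to the left of 0 and \<open>t\<close>,
    \<open>G\<close> is an ordinary indefinite integral up to a constant, so the case split at 0 is
    gone before differentiating.\<close>
  have G_eq: "G t = integral {a..t} g - integral {a..0} g" if "a \<le> 0" "a \<le> t" for a t
  proof (cases "0 \<le> t")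
    case True
    thus ?thesis using Henstock_Kurzweil_Integration.integral_combine[OF that(1) True int] that
      by (simp add: G_def algebra_simps)
  next
    case False
    hence "t \<le> 0" by simp
    thus ?thesis using Henstock_Kurzweil_Integration.integral_combine[OF that(2) \<open>t \<le> 0\<close> int] False
      by (simp add: G_def algebra_simps)
  qed
  have "(G has_vector_derivative g t) (at t)" for t
  proof -
    define a b where "a = min 0 t - 1" and "b = t + 1"
    have ab: "a < t" "t < b" "a \<le> 0" by (auto simp: a_def b_def)
    have "((\<lambda>u. integral {a..u} g) has_vector_derivative g t) (at t within {a..b})"
      using ab by (intro integral_has_vector_derivative continuous_on_subset[OF assms]) auto
    hence "((\<lambda>u. integral {a..u} g) has_vector_derivative g t) (at t)"
      using ab at_within_Icc_at[of a t b] by simp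
    hence "((\<lambda>u. integral {a..u} g - integral {a..0} g) has_vector_derivative g t) (at t)"
      by (auto intro!: derivative_eq_intros)
    thus ?thesis
      by (rule has_vector_derivative_transform_within_open[where S = "{a<..<b}"])
        (use ab G_eq in auto)
  qed
  moreover have "G 0 = 0" by (simp add: G_def)
  ultimately show ?thesis by blast
qed

text \<open>For positive times the bound on \<open>g\<close> is the derivative of
  \<open>C / K * exp (K * t)\<close>, and the mean value inequality compares the two; reflection
  handles negative times. The gained factor \<open>1 / K\<close> is what makes the Picard operator a
  contraction.\<close>

lemma exp_bound_antiderivative:
  fixes G :: "real \<Rightarrow> 'a::real_normed_vector"
  assumes "G 0 = 0" and G: "\<And>t. (G has_vector_derivative g t) (at t)"
    and "K > 0" "C \<ge> 0" and bound: "\<And>s. norm (g s) \<le> C * exp (K * \<bar>s\<bar>)"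
  shows "norm (G t) \<le> C / K * exp (K * \<bar>t\<bar>)"
proof -
  have *: "norm (G t) \<le> C / K * exp (K * t)"
    if "0 \<le> t" "G 0 = 0" and G: "\<And>t. (G has_vector_derivative g t) (at t)"
      and bound: "\<And>s. norm (g s) \<le> C * exp (K * \<bar>s\<bar>)"
    for G :: "real \<Rightarrow> 'a" and g t
  proof (cases "t = 0")
    case False
    hence "0 < t" using that by simp
    have "norm (G t - G 0) \<le> C / K * exp (K * t) - C / K * exp (K * 0)"
    proof (rule differentiable_bound_general[OF \<open>0 < t\<close>, where f' = g and
           \<phi>' = "\<lambda>s. C * exp (K * s)" and \<phi> = "\<lambda>s. C / K * exp (K * s)"])
      show "continuous_on {0..t} G"
        by (intro continuous_at_imp_continuous_on ballI has_vector_derivative_continuous[OF G])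
      show "continuous_on {0..t} (\<lambda>s. C / K * exp (K * s))" by (intro continuous_intros)
      show "((\<lambda>s. C / K * exp (K * s)) has_vector_derivative C * exp (K * x)) (at x)" for x
        unfolding has_real_derivative_iff_has_vector_derivative[symmetric]
        using \<open>K > 0\<close> by (auto intro!: derivative_eq_intros)
      show "norm (g x) \<le> C * exp (K * x)" if "0 < x" for x
        using bound[of x] that by simp
    qed (rule G)
    also have "\<dots> \<le> C / K * exp (K * t)" using assms by simp
    finally show ?thesis using that by simp
  qed (use that assms in auto)
  show ?thesis
  proof (cases "0 \<le> t")
    case True
    thus ?thesis using *[of t G g] assms by simp
  next
    case False
    have "((\<lambda>s. G (- s)) has_vector_derivative - g (- s)) (at s)" for s
      using vector_diff_chain_at[OF has_vector_derivative_minus[OF has_vector_derivative_id] G]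
      by (simp add: o_def)
    thus ?thesis using *[of "- t" "\<lambda>s. G (- s)" "\<lambda>s. - g (- s)"] bound[of "- s" for s] assms False by simp
  qed
qed

text \<open>Functions that grow like \<open>exp (K * \<bar>t\<bar>)\<close> are rescaled to bounded ones; for
  \<open>K = 2 * L\<close> the Picard operator is then a contraction on the whole real line at once.\<close>

lemma lipschitz_ode_global_solution:
  fixes f :: "'a::banach \<Rightarrow> 'a"
  assumes "L-lipschitz_on UNIV f"
  shows "\<exists>x. x t\<^sub>0 = x\<^sub>0 \<and> (\<forall>t. (x has_vector_derivative f (x t)) (at t))"
proof -
  \<comment> \<open>Passing from \<open>L\<close> to \<open>L + 1\<close> makes the Lipschitz
    constant positive, hence also \<open>K\<close>, by which the estimates divide. The ratio
    \<open>M / K\<close> is the contraction factor 1/2.\<close>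
  define M where "M = L + 1"
  define K where "K = 2 * M"
  have "0 \<le> L" using assms by (rule lipschitz_on_nonneg)
  have lip: "M-lipschitz_on UNIV f"
    using assms by (rule lipschitz_on_mono) (auto simp: M_def)
  have M: "M > 0" "K > 0" using \<open>0 \<le> L\<close> by (auto simp: M_def K_def)
  have contf: "continuous_on UNIV f" using lip by (rule lipschitz_on_continuous_on)
  obtain J :: "(real \<Rightarrow> 'a) \<Rightarrow> real \<Rightarrow> 'a"
    where J0: "\<And>g. continuous_on UNIV g \<Longrightarrow> J g 0 = 0"
      and J: "\<And>g t. continuous_on UNIV g \<Longrightarrow> (J g has_vector_derivative g t) (at t)"
    using continuous_on_antiderivative by metis
  \<comment> \<open>\<open>F w\<close> is \<open>f\<close> along the unscaled function;
    \<open>Q w\<close> below is the Picard iterate scaled back by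
    \<open>exp (- K * \<bar>t\<bar>)\<close>.\<close>
  define F :: "(real \<Rightarrow>\<^sub>C 'a) \<Rightarrow> real \<Rightarrow> 'a"
    where "F w = (\<lambda>s. f (exp (K * \<bar>s\<bar>) *\<^sub>R w s))" for w
  have contF: "continuous_on UNIV (F w)" for w
    unfolding F_def
    by (rule continuous_on_compose2[OF contf]) (auto intro!: continuous_intros)
  define Q where "Q w t = exp (- K * \<bar>t\<bar>) *\<^sub>R (x\<^sub>0 + J (F w) t)" for w t
  have contJ: "continuous_on UNIV (J (F w))" for w
    by (intro continuous_at_imp_continuous_on ballI has_vector_derivative_continuous[OF J] contF)
  have Q_bcont: "Q w \<in> bcontfun" for w
  proof (rule bcontfun_normI)
    show "continuous_on UNIV (Q w)" unfolding Q_def by (intro continuous_intros contJ)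
    define C where "C = norm (f 0) + M * norm w"
    have C: "C \<ge> 0" using M by (simp add: C_def)
    \<comment> \<open>A Lipschitz map grows at most linearly, and the constant
      \<open>norm (f 0)\<close> is absorbed because the exponential is at least 1.\<close>
    have "norm (F w s) \<le> C * exp (K * \<bar>s\<bar>)" for s
    proof -
      have "norm (F w s) \<le> norm (f 0) + norm (F w s - f 0)"
        using norm_triangle_ineq[of "f 0" "F w s - f 0"] by simp
      also have "norm (F w s - f 0) \<le> M * norm (exp (K * \<bar>s\<bar>) *\<^sub>R w s)"
        using lipschitz_on_normD[OF lip, of "exp (K * \<bar>s\<bar>) *\<^sub>R w s" 0] by (simp add: F_def)
      also have "\<dots> \<le> M * (exp (K * \<bar>s\<bar>) * norm w)"
        using M norm_bounded[of w s] by (simp add: mult_left_mono)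
      also have "norm (f 0) \<le> norm (f 0) * exp (K * \<bar>s\<bar>)"
        using M by (simp add: mult_le_cancel_left1)
      finally show ?thesis by (simp add: C_def algebra_simps)
    qed
    note JB = exp_bound_antiderivative[OF J0[OF contF] J[OF contF] M(2) C this]
    show "norm (Q w t) \<le> norm x\<^sub>0 + C / K" for t
    proof -
      have "norm (Q w t) \<le> exp (- K * \<bar>t\<bar>) * (norm x\<^sub>0 + C / K * exp (K * \<bar>t\<bar>))"
        unfolding Q_def norm_scaleR
        using JB[of t] norm_triangle_ineq[of x\<^sub>0 "J (F w) t"] by (intro mult_mono) auto
      also have "\<dots> = exp (- K * \<bar>t\<bar>) * norm x\<^sub>0 + C / K * (exp (- K * \<bar>t\<bar>) * exp (K * \<bar>t\<bar>))"
        by (simp add: algebra_simps)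
      also have "exp (- K * \<bar>t\<bar>) * exp (K * \<bar>t\<bar>) = 1" by (simp flip: exp_add)
      also have "exp (- K * \<bar>t\<bar>) * norm x\<^sub>0 \<le> 1 * norm x\<^sub>0"
        using M by (intro mult_right_mono) auto
      finally show ?thesis by simp
    qed
  qed
  \<comment> \<open>\<open>P\<close> is \<open>Q\<close> as a self-map of the complete space of
    bounded continuous functions, where Banach's fixed point theorem applies.\<close>
  define P where "P w = Bcontfun (Q w)" for w
  have P: "apply_bcontfun (P w) = Q w" for w
    using Q_bcont by (simp add: P_def Bcontfun_inverse)
  have "dist (P v) (P w) \<le> 1/2 * dist v w" for v w
  proof (rule dist_bound)
    fix t
    have D0: "(\<lambda>t. J (F v) t - J (F w) t) 0 = 0" using J0 contF by simp
    have D: "((\<lambda>t. J (F v) t - J (F w) t) has_vector_derivative F v s - F w s) (at s)" for s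
      by (intro has_vector_derivative_diff J contF)
    have B: "norm (F v s - F w s) \<le> (M * dist v w) * exp (K * \<bar>s\<bar>)" for s
    proof -
      have "norm (F v s - F w s) \<le> M * norm (exp (K * \<bar>s\<bar>) *\<^sub>R v s - exp (K * \<bar>s\<bar>) *\<^sub>R w s)"
        using lipschitz_on_normD[OF lip] by (simp add: F_def)
      also have "\<dots> = M * (exp (K * \<bar>s\<bar>) * dist (v s) (w s))"
        by (simp add: dist_norm flip: scaleR_diff_right)
      also have "\<dots> \<le> M * (exp (K * \<bar>s\<bar>) * dist v w)"
        using M dist_bounded[of v s w] by (intro mult_left_mono) auto
      finally show ?thesis by (simp add: algebra_simps)
    qed
    have "norm (J (F v) t - J (F w) t) \<le> (M * dist v w) / K * exp (K * \<bar>t\<bar>)"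
      using exp_bound_antiderivative[OF D0 D M(2) _ B] M by simp
    also have "(M * dist v w) / K = dist v w / 2" using M by (simp add: K_def)
    finally have N: "norm (J (F v) t - J (F w) t) \<le> dist v w / 2 * exp (K * \<bar>t\<bar>)" .
    have "dist (P v t) (P w t) = exp (- K * \<bar>t\<bar>) * norm (J (F v) t - J (F w) t)"
      by (simp add: P Q_def dist_norm flip: scaleR_diff_right)
    also have "\<dots> \<le> exp (- K * \<bar>t\<bar>) * (dist v w / 2 * exp (K * \<bar>t\<bar>))"
      using N by (intro mult_left_mono) auto
    also have "\<dots> = dist v w / 2 * (exp (- K * \<bar>t\<bar>) * exp (K * \<bar>t\<bar>))" by simp
    also have "exp (- K * \<bar>t\<bar>) * exp (K * \<bar>t\<bar>) = 1" by (simp flip: exp_add)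
    finally show "dist (P v t) (P w t) \<le> 1/2 * dist v w" by simp
  qed
  then obtain w where w: "P w = w"
    using banach_fix_type[of "1/2" P] by auto
  \<comment> \<open>Undoing the rescaling turns the fixed point into a solution of the integral
    equation.\<close>
  define x where "x t = exp (K * \<bar>t\<bar>) *\<^sub>R w t" for t
  have x_eq: "x t = x\<^sub>0 + J (F w) t" for t
  proof -
    have "x t = (exp (K * \<bar>t\<bar>) * exp (- K * \<bar>t\<bar>)) *\<^sub>R (x\<^sub>0 + J (F w) t)"
      using P[of w] by (simp add: x_def w Q_def)
    also have "exp (K * \<bar>t\<bar>) * exp (- K * \<bar>t\<bar>) = 1" by (simp flip: exp_add)
    finally show ?thesis by simp
  qed
  have x': "(x has_vector_derivative f (x t)) (at t)" for t
  proof -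
    have "((\<lambda>t. x\<^sub>0 + J (F w) t) has_vector_derivative 0 + F w t) (at t)"
      by (intro has_vector_derivative_add has_vector_derivative_const J contF)
    moreover have "F w t = f (x t)" by (simp add: F_def x_def)
    moreover have "x = (\<lambda>t. x\<^sub>0 + J (F w) t)" using x_eq by blast
    ultimately show ?thesis by simp
  qed
  \<comment> \<open>The equation is autonomous, so a time shift moves the initial time from 0 to
    \<open>t\<^sub>0\<close>.\<close>
  have "((\<lambda>s. x (s - t\<^sub>0)) has_vector_derivative f (x (t - t\<^sub>0))) (at t)" for t
    using vector_diff_chain_at[OF has_vector_derivative_diff[OF has_vector_derivative_id
      has_vector_derivative_const[of t\<^sub>0]] x']
    by (simp add: o_def)
  moreover have "x 0 = x\<^sub>0" using x_eq[of 0] J0[OF contF] by simp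
  ultimately show ?thesis by (intro exI[of _ "\<lambda>s. x (s - t\<^sub>0)"]) simp
qed

subsection \<open>The modified system and its energy\<close>

text \<open>The term \<open>k = i\<close> is included: it vanishes whatever its coefficient, and
  sums over the full index set can be swapped directly.\<close>

definition cutoff_force :: "real \<Rightarrow> real^'m^'m \<Rightarrow> real^'m^'m \<Rightarrow> real^'m^'m" where
  "cutoff_force \<delta> H X = (\<chi> i. \<Sum>k\<in>UNIV.
     (1 / max ((norm (X $ i - X $ k))\<^sup>2) \<delta> - H $ i $ k) *\<^sub>R (X $ i - X $ k))"

lemma cutoff_force_eq_force:
  assumes "\<And>i k. i \<noteq> k \<Longrightarrow> \<delta> \<le> (norm (X $ i - X $ k))\<^sup>2"
  shows "cutoff_force \<delta> H X = force H X"
proof -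
  have "cutoff_force \<delta> H X $ i $ j = force H X $ i $ j" for i j
  proof -
    have "cutoff_force \<delta> H X $ i $ j = (\<Sum>k\<in>UNIV - {i}.
        (1 / max ((norm (X $ i - X $ k))\<^sup>2) \<delta> - H $ i $ k) * (X $ i $ j - X $ k $ j))"
      unfolding cutoff_force_def by (simp add: sum.remove[of _ i])
    also have "\<dots> = force H X $ i $ j"
      unfolding force_def using assms[of i] by (auto intro!: sum.cong)
    finally show ?thesis .
  qed
  thus ?thesis by (simp add: vec_eq_iff)
qed

definition cutoff_ln :: "real \<Rightarrow> real \<Rightarrow> real" where
  "cutoff_ln \<delta> s = (if \<delta> \<le> s then ln s else ln \<delta> + s / \<delta> - 1)"

text \<open>At \<open>\<delta>\<close> the two branches agree in value and slope. The closures of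
  the two half-lines meet only there, so this is all that gluing requires.\<close>

lemma DERIV_cutoff_ln:
  assumes "0 < \<delta>"
  shows "(cutoff_ln \<delta> has_real_derivative 1 / max s \<delta>) (at s)"
proof -
  have "((\<lambda>s. if s \<in> {\<delta>..} then ln s else ln \<delta> + s / \<delta> - 1) has_vector_derivative
      (if s \<in> {\<delta>..} then 1 / s else 1 / \<delta>)) (at s within UNIV)"
  proof (rule has_vector_derivative_If_within_closures[where T = "{..<\<delta>}"])
    show "(ln has_vector_derivative 1 / s) (at s within {\<delta>..} \<union> closure {\<delta>..} \<inter> closure {..<\<delta>})"
      if "s \<in> {\<delta>..} \<union> closure {\<delta>..} \<inter> closure {..<\<delta>}"
      unfolding has_real_derivative_iff_has_vector_derivative[symmetric]
      using that assms by (intro has_field_derivative_at_within[OF DERIV_ln_divide]) auto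
    show "((\<lambda>s. ln \<delta> + s / \<delta> - 1) has_vector_derivative 1 / \<delta>)
        (at s within {..<\<delta>} \<union> closure {\<delta>..} \<inter> closure {..<\<delta>})"
      unfolding has_real_derivative_iff_has_vector_derivative[symmetric]
      using assms by (auto intro!: derivative_eq_intros)
  qed (use assms in auto)
  moreover have "(if s \<in> {\<delta>..} then 1 / s else 1 / \<delta>) = 1 / max s \<delta>" by (auto simp: max_def)
  moreover have "cutoff_ln \<delta> = (\<lambda>s. if s \<in> {\<delta>..} then ln s else ln \<delta> + s / \<delta> - 1)"
    by (auto simp: cutoff_ln_def fun_eq_iff)
  ultimately show ?thesis by (simp add: has_real_derivative_iff_has_vector_derivative)
qed

lemma cutoff_ln_le:
  assumes "0 < \<delta>" "s < \<delta>"
  shows "cutoff_ln \<delta> s \<le> ln \<delta>"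
  using assms by (simp add: cutoff_ln_def field_simps)

text \<open>This gives an upper bound free of \<open>\<delta>\<close>: above the cutoff it is
  \<open>ln s \<le> s\<close>, and below it the value is at most
  \<open>ln \<delta> \<le> 0\<close>.\<close>

lemma cutoff_ln_le_self:
  assumes "0 < \<delta>" "\<delta> \<le> 1" "0 \<le> s"
  shows "cutoff_ln \<delta> s \<le> s"
proof (cases "\<delta> \<le> s")
  case True
  thus ?thesis using assms ln_bound[of s] by (simp add: cutoff_ln_def)
next
  case False
  thus ?thesis using assms cutoff_ln_le[of \<delta> s] ln_le_zero_iff[of \<delta>] by linarith
qed

text \<open>The logarithm is concave, so it lies below its tangent line at
  \<open>\<delta>\<close>.\<close>

lemma ln_le_cutoff_ln:
  assumes "0 < \<delta>" "0 < s"
  shows "ln s \<le> cutoff_ln \<delta> s"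
  using assms ln_le_minus_one[of "s / \<delta>"] by (simp add: cutoff_ln_def ln_div)

section \<open>Lipschitz continuity of the modified vector field\<close>

lemma lipschitz_on_UNIV_sum:
  fixes f :: "'i \<Rightarrow> 'a::metric_space \<Rightarrow> 'b::real_normed_vector"
  assumes "\<And>i. i \<in> A \<Longrightarrow> \<exists>L. L-lipschitz_on UNIV (f i)"
  shows "\<exists>L. L-lipschitz_on UNIV (\<lambda>x. \<Sum>i\<in>A. f i x)"
  using assms
proof (induction A rule: infinite_finite_induct)
  case (insert i A)
  then obtain L M where "L-lipschitz_on UNIV (f i)" "M-lipschitz_on UNIV (\<lambda>x. \<Sum>i\<in>A. f i x)"
    by blast
  from lipschitz_on_add[OF this] show ?case using insert by auto
qed (auto intro: lipschitz_on_constant)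

text \<open>Outside the ball of radius \<open>sqrt \<delta>\<close> the map is inversion in the unit
  sphere, inside it is division by \<open>\<delta>\<close>. Of the constant
  \<open>3 / \<delta>\<close>, one share comes from the difference of the vectors and two from the
  difference of their coefficients.\<close>

lemma lipschitz_on_cutoff_inversion:
  fixes \<delta> :: real
  assumes "0 < \<delta>"
  shows "(3 / \<delta>)-lipschitz_on UNIV (\<lambda>v::'a::real_normed_vector. (1 / max ((norm v)\<^sup>2) \<delta>) *\<^sub>R v)"
proof (rule lipschitz_onI)
  fix v w :: 'a
  define m where "m u = max ((norm u)\<^sup>2) \<delta>" for u :: 'a
  have m: "\<delta> \<le> m u" "0 < m u" "(norm u)\<^sup>2 \<le> m u" for u using assms by (auto simp: m_def)
  \<comment> \<open>The product is at most the square of the larger norm, hence at most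
    \<open>m w\<close>, and the remaining factor \<open>m u / \<delta>\<close> is at least
    1.\<close>
  have nm: "norm u * norm w \<le> m w * m u / \<delta>" if "norm u \<le> norm w" for u w
  proof -
    have "norm u * norm w \<le> norm w * norm w" using that by (intro mult_right_mono) auto
    also have "\<dots> \<le> m w" using m(3)[of w] by (simp add: power2_eq_square)
    also have "\<dots> \<le> m w * (m u / \<delta>)"
      using mult_left_mono[of 1 "m u / \<delta>" "m w"] m(1)[of u] m(2)[of w] assms by simp
    finally show ?thesis by simp
  qed
  have nn: "norm u * norm w \<le> m w * m u / \<delta>" for u w
    using nm[of u w] nm[of w u] by (cases "norm u \<le> norm w") (auto simp: mult.commute)
  have "\<bar>m w - m v\<bar> \<le> \<bar>(norm w)\<^sup>2 - (norm v)\<^sup>2\<bar>" by (auto simp: m_def max_def)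
  also have "\<dots> = \<bar>norm w - norm v\<bar> * (norm w + norm v)"
    by (simp add: power2_eq_square square_diff_square_factored abs_mult)
  also have "\<dots> \<le> norm (v - w) * (norm w + norm v)"
    using norm_triangle_ineq3[of w v] by (intro mult_right_mono) (auto simp: norm_minus_commute)
  finally have mm: "\<bar>m w - m v\<bar> \<le> norm (v - w) * (norm w + norm v)" .
  \<comment> \<open>The difference is split into a change of vector with the coefficient of
    \<open>v\<close> and a change of coefficient at the vector \<open>w\<close>.\<close>
  have "(m w - m v) / (m v * m w) = 1 / m v - 1 / m w"
    using m(2)[of v] m(2)[of w] by (simp add: field_simps)
  hence "(1 / m v) *\<^sub>R v - (1 / m w) *\<^sub>R w = (1 / m v) *\<^sub>R (v - w) + ((m w - m v) / (m v * m w)) *\<^sub>R w"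
    by (simp only: scaleR_diff_left scaleR_diff_right) simp
  also have "norm \<dots> \<le> norm (v - w) / m v + \<bar>m w - m v\<bar> * norm w / (m v * m w)"
    using m(2)[of v] m(2)[of w] by (intro norm_triangle_le) (simp add: abs_mult)
  also have "\<bar>m w - m v\<bar> * norm w / (m v * m w)
      \<le> norm (v - w) * (norm w + norm v) * norm w / (m v * m w)"
    using mm m(2)[of v] m(2)[of w] by (intro divide_right_mono mult_right_mono) auto
  also have "\<dots> = norm (v - w) * ((norm w * norm w) / (m v * m w) + norm v * norm w / (m v * m w))"
    by (simp add: algebra_simps add_divide_distrib)
  also have "\<dots> \<le> norm (v - w) * (1 / \<delta> + 1 / \<delta>)"
  proof (intro mult_left_mono add_mono)
    have "norm w * norm w \<le> m w" using m(3)[of w] by (simp add: power2_eq_square)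
    hence "(norm w * norm w) / (m v * m w) \<le> m w / (m v * m w)"
      using m(2)[of v] m(2)[of w] by (intro divide_right_mono) auto
    also have "\<dots> = 1 / m v" using m(2)[of w] by simp
    also have "\<dots> \<le> 1 / \<delta>" using m(1)[of v] assms by (simp add: frac_le)
    finally show "(norm w * norm w) / (m v * m w) \<le> 1 / \<delta>" .
    have "norm v * norm w / (m v * m w) \<le> (m w * m v / \<delta>) / (m v * m w)"
      using nn[of v w] m(2)[of v] m(2)[of w] by (intro divide_right_mono) auto
    also have "\<dots> = 1 / \<delta>" using m(2)[of v] m(2)[of w] by simp
    finally show "norm v * norm w / (m v * m w) \<le> 1 / \<delta>" .
  qed simp
  also have "norm (v - w) / m v \<le> norm (v - w) / \<delta>"
    using m(1)[of v] assms by (simp add: frac_le)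
  finally show "dist ((1 / max ((norm v)\<^sup>2) \<delta>) *\<^sub>R v) ((1 / max ((norm w)\<^sup>2) \<delta>) *\<^sub>R w) \<le> 3 / \<delta> * dist v w"
    by (simp add: dist_norm m_def algebra_simps)
qed (use assms in simp)

lemma bounded_linear_imp_lipschitz:
  assumes "bounded_linear f"
  shows "\<exists>L. L-lipschitz_on UNIV f"
  using bounded_linear.lipschitz_boundE[OF assms] by metis

text \<open>Embedding rows by \<open>axis i\<close> writes the force as a finite sum over pairs of
  indices. Each summand is the cutoff inversion minus a multiple of the identity, composed on both
  sides with bounded linear maps.\<close>

lemma lipschitz_cutoff_force:
  fixes H :: "real^'m^'m"
  assumes "0 < \<delta>"
  shows "\<exists>L. L-lipschitz_on UNIV (cutoff_force \<delta> H)"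
proof -
  have row: "bounded_linear (\<lambda>X::real^'m^'m. X $ i - X $ k)" for i k
    by (intro bounded_linear_sub bounded_linear_vec_nth)
  have axis: "bounded_linear (\<lambda>v::real^'m. axis i v :: real^'m^'m)" for i
    by (auto intro!: linear_conv_bounded_linear[THEN iffD1] linearI simp: axis_def vec_eq_iff)
  have term_lip: "\<exists>L. L-lipschitz_on UNIV (\<lambda>X::real^'m^'m. axis i
      ((1 / max ((norm (X $ i - X $ k))\<^sup>2) \<delta> - H $ i $ k) *\<^sub>R (X $ i - X $ k)) :: real^'m^'m)" for i k
  proof -
    have "\<exists>L. L-lipschitz_on UNIV (\<lambda>v::real^'m. (1 / max ((norm v)\<^sup>2) \<delta>) *\<^sub>R v - (H $ i $ k) *\<^sub>R v)"
      using lipschitz_on_diff[OF lipschitz_on_cutoff_inversion[OF assms]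
          lipschitz_on_cmult[OF lipschitz_on_id]] by blast
    then obtain L M N where
      "L-lipschitz_on UNIV (\<lambda>v::real^'m. (1 / max ((norm v)\<^sup>2) \<delta>) *\<^sub>R v - (H $ i $ k) *\<^sub>R v)"
      "M-lipschitz_on UNIV (\<lambda>X::real^'m^'m. X $ i - X $ k)"
      "N-lipschitz_on UNIV (\<lambda>v::real^'m. axis i v :: real^'m^'m)"
      using bounded_linear_imp_lipschitz[OF row[of i k]] bounded_linear_imp_lipschitz[OF axis[of i]] by blast
    hence "(N * (L * M))-lipschitz_on UNIV (\<lambda>X::real^'m^'m. axis i
        ((1 / max ((norm (X $ i - X $ k))\<^sup>2) \<delta>) *\<^sub>R (X $ i - X $ k)
          - (H $ i $ k) *\<^sub>R (X $ i - X $ k)) :: real^'m^'m)"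
      by (intro lipschitz_on_compose2[where g = "axis i"]
          lipschitz_on_compose2[where g = "\<lambda>v. (1 / max ((norm v)\<^sup>2) \<delta>) *\<^sub>R v - (H $ i $ k) *\<^sub>R v"])
        (auto intro: lipschitz_on_subset)
    thus ?thesis by (auto simp: scaleR_diff_left)
  qed
  have axis_sum: "(\<Sum>i\<in>UNIV. \<Sum>k\<in>UNIV. axis i (u i k)) = (\<chi> i. \<Sum>k\<in>UNIV. u i k)"
    for u :: "'m \<Rightarrow> 'm \<Rightarrow> real^'m"
  proof -
    have "(\<Sum>k\<in>UNIV. axis i (u i k) $ p) = (if i = p then \<Sum>k\<in>UNIV. u i k else 0)" for i p
      by (simp add: axis_def)
    thus ?thesis by (simp add: vec_eq_iff[of _ "\<chi> i. \<Sum>k\<in>UNIV. u i k"])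
  qed
  have "cutoff_force \<delta> H = (\<lambda>X. \<Sum>i\<in>UNIV. \<Sum>k\<in>UNIV. axis i
      ((1 / max ((norm (X $ i - X $ k))\<^sup>2) \<delta> - H $ i $ k) *\<^sub>R (X $ i - X $ k)))"
    unfolding axis_sum by (rule ext) (rule cutoff_force_def)
  thus ?thesis using lipschitz_on_UNIV_sum[OF lipschitz_on_UNIV_sum[OF term_lip]] by simp
qed

definition cutoff_field ::
  "real \<Rightarrow> real^'m^'m \<Rightarrow> (real^'m^'m) \<times> (real^'m^'m) \<Rightarrow> (real^'m^'m) \<times> (real^'m^'m)" where
  "cutoff_field \<delta> H Z = (snd Z, cutoff_force \<delta> H (fst Z))"

lemma lipschitz_cutoff_field:
  fixes H :: "real^'m^'m"
  assumes "0 < \<delta>"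
  shows "\<exists>L. L-lipschitz_on UNIV (cutoff_field \<delta> H)"
proof -
  obtain K L M where "K-lipschitz_on UNIV (cutoff_force \<delta> H)"
    "L-lipschitz_on UNIV (fst :: (real^'m^'m) \<times> (real^'m^'m) \<Rightarrow> _)"
    "M-lipschitz_on UNIV (snd :: (real^'m^'m) \<times> (real^'m^'m) \<Rightarrow> _)"
    using lipschitz_cutoff_force[OF assms] bounded_linear_imp_lipschitz[OF bounded_linear_fst]
      bounded_linear_imp_lipschitz[OF bounded_linear_snd] by blast
  hence "(sqrt (M\<^sup>2 + (K * L)\<^sup>2))-lipschitz_on UNIV (cutoff_field \<delta> H)"
    unfolding cutoff_field_def[abs_def]
    by (intro lipschitz_on_Pair lipschitz_on_compose2[where g = "cutoff_force \<delta> H"])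
      (auto intro: lipschitz_on_subset)
  thus ?thesis by blast
qed

text \<open>For symmetric \<open>H\<close> this is twice the sum of kinetic and potential energy.
  The factor 1/2 compensates for counting every unordered pair of rows twice.\<close>

definition cutoff_energy :: "real \<Rightarrow> real^'m^'m \<Rightarrow> real^'m^'m \<Rightarrow> real^'m^'m \<Rightarrow> real" where
  "cutoff_energy \<delta> H X Y = Y \<bullet> Y - 1/2 * (\<Sum>i\<in>UNIV. \<Sum>k\<in>UNIV - {i}.
     cutoff_ln \<delta> ((X $ i - X $ k) \<bullet> (X $ i - X $ k)) - H $ i $ k * ((X $ i - X $ k) \<bullet> (X $ i - X $ k)))"

text \<open>The coefficients are symmetric in \<open>i\<close> and \<open>k\<close> and the row
  differences antisymmetric, so exchanging the indices turns the sum with \<open>Y $ k\<close> into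
  the negative of the sum with \<open>Y $ i\<close>. This is action and reaction, and it needs the
  symmetry of \<open>H\<close>.\<close>

lemma inner_cutoff_force:
  fixes H X Y :: "real^'m^'m"
  assumes sym: "\<And>i k. H $ i $ k = H $ k $ i"
  shows "2 * (Y \<bullet> cutoff_force \<delta> H X) = (\<Sum>i\<in>UNIV. \<Sum>k\<in>UNIV.
    (1 / max ((norm (X $ i - X $ k))\<^sup>2) \<delta> - H $ i $ k) * ((X $ i - X $ k) \<bullet> (Y $ i - Y $ k)))"
proof -
  define g where "g i k = 1 / max ((norm (X $ i - X $ k))\<^sup>2) \<delta> - H $ i $ k" for i k
  have g: "g i k = g k i" for i k by (simp add: g_def norm_minus_commute sym[of i k])
  have YF: "Y \<bullet> cutoff_force \<delta> H X = (\<Sum>i\<in>UNIV. \<Sum>k\<in>UNIV. g i k * ((X $ i - X $ k) \<bullet> Y $ i))"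
    unfolding inner_vec_def[of Y] cutoff_force_def
    by (simp add: inner_sum_right g_def inner_commute)
  have "(\<Sum>i\<in>UNIV. \<Sum>k\<in>UNIV. g i k * ((X $ i - X $ k) \<bullet> Y $ k))
      = (\<Sum>k\<in>UNIV. \<Sum>i\<in>UNIV. g i k * ((X $ i - X $ k) \<bullet> Y $ k))"
    by (rule sum.swap)
  also have "\<dots> = (\<Sum>k\<in>UNIV. \<Sum>i\<in>UNIV. - (g k i * ((X $ k - X $ i) \<bullet> Y $ k)))"
    using g by (intro sum.cong refl) (simp add: inner_diff_left algebra_simps)
  also have "\<dots> = - (Y \<bullet> cutoff_force \<delta> H X)" by (simp add: YF sum_negf)
  finally show ?thesis
    unfolding g_def[symmetric] by (simp add: inner_diff_right right_diff_distrib sum_subtractf YF)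
qed

text \<open>The derivative of \<open>Y \<bullet> Y\<close> is twice the power of the force, which by
  \<open>inner_cutoff_force\<close> cancels the derivative of the pair terms.\<close>

lemma cutoff_energy_conserved:
  fixes H :: "real^'m^'m"
  assumes "0 < \<delta>" and sym: "\<And>i k. H $ i $ k = H $ k $ i"
    and X: "\<And>t. (X has_vector_derivative Y t) (at t)"
    and Y: "\<And>t. (Y has_vector_derivative cutoff_force \<delta> H (X t)) (at t)"
  shows "cutoff_energy \<delta> H (X t) (Y t) = cutoff_energy \<delta> H (X t\<^sub>0) (Y t\<^sub>0)"
proof -
  have "((\<lambda>t. cutoff_energy \<delta> H (X t) (Y t)) has_real_derivative 0) (at t)" for t
  proof -
    define g where "g i k = 1 / max ((norm (X t $ i - X t $ k))\<^sup>2) \<delta> - H $ i $ k" for i k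
    have pair: "((\<lambda>t. cutoff_ln \<delta> ((X t $ i - X t $ k) \<bullet> (X t $ i - X t $ k))
          - H $ i $ k * ((X t $ i - X t $ k) \<bullet> (X t $ i - X t $ k)))
        has_real_derivative 2 * (g i k * ((X t $ i - X t $ k) \<bullet> (Y t $ i - Y t $ k)))) (at t)" for i k
    proof -
      have nth: "((\<lambda>t. X t $ j) has_vector_derivative Y t $ j) (at t)" for j
        using bounded_linear.has_vector_derivative[OF bounded_linear_vec_nth X] .
      have d: "((\<lambda>t. X t $ i - X t $ k) has_vector_derivative Y t $ i - Y t $ k) (at t)"
        by (intro has_vector_derivative_diff nth)
      have s: "((\<lambda>t. (X t $ i - X t $ k) \<bullet> (X t $ i - X t $ k)) has_real_derivative
          2 * ((X t $ i - X t $ k) \<bullet> (Y t $ i - Y t $ k))) (at t)"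
        using has_real_derivative_inner[OF d d] by (simp add: inner_commute)
      show ?thesis
        using DERIV_diff[OF DERIV_chain2[OF DERIV_cutoff_ln[OF \<open>0 < \<delta>\<close>] s] DERIV_cmult[OF s, of "H $ i $ k"]]
        by (rule DERIV_cong) (simp only: g_def power2_norm_eq_inner left_diff_distrib
            right_diff_distrib mult.left_commute mult_2 distrib_left distrib_right mult.assoc)
    qed
    have "((\<lambda>t. cutoff_energy \<delta> H (X t) (Y t)) has_real_derivative
        (Y t \<bullet> cutoff_force \<delta> H (X t) + cutoff_force \<delta> H (X t) \<bullet> Y t) - 1/2 *
        (\<Sum>i\<in>UNIV. \<Sum>k\<in>UNIV - {i}. 2 * (g i k * ((X t $ i - X t $ k) \<bullet> (Y t $ i - Y t $ k))))) (at t)"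
      unfolding cutoff_energy_def
      by (intro DERIV_diff has_real_derivative_inner Y DERIV_cmult DERIV_sum pair)
    \<comment> \<open>The diagonal terms vanish, so the sum may be extended to all pairs.\<close>
    moreover have "(\<Sum>i\<in>UNIV. \<Sum>k\<in>UNIV - {i}. 2 * (g i k * ((X t $ i - X t $ k) \<bullet> (Y t $ i - Y t $ k))))
        = 2 * (\<Sum>i\<in>UNIV. \<Sum>k\<in>UNIV. g i k * ((X t $ i - X t $ k) \<bullet> (Y t $ i - Y t $ k)))"
      unfolding sum_distrib_left by (intro sum.cong refl sum.mono_neutral_left) auto
    moreover have "2 * (Y t \<bullet> cutoff_force \<delta> H (X t))
        = (\<Sum>i\<in>UNIV. \<Sum>k\<in>UNIV. g i k * ((X t $ i - X t $ k) \<bullet> (Y t $ i - Y t $ k)))"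
      unfolding g_def by (rule inner_cutoff_force[OF sym])
    ultimately show ?thesis by (simp add: inner_commute)
  qed
  thus ?thesis by (intro DERIV_isconst_all) blast
qed

subsection \<open>Separation of the rows and global existence\<close>

lemma off_diagonal_sum_le:
  fixes a :: "'m::finite \<Rightarrow> 'm \<Rightarrow> real"
  assumes "\<And>i k. i \<noteq> k \<Longrightarrow> a i k \<le> b" "0 \<le> b"
  shows "(\<Sum>i\<in>UNIV. \<Sum>k\<in>UNIV - {i}. a i k) \<le> (real CARD('m))\<^sup>2 * b"
proof -
  have "(\<Sum>k\<in>UNIV - {i}. a i k) \<le> real CARD('m) * b" for i
  proof -
    have "(\<Sum>k\<in>UNIV - {i}. a i k) \<le> (\<Sum>k\<in>UNIV - {i}. b)" using assms by (intro sum_mono) auto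
    also have "\<dots> \<le> (\<Sum>k\<in>(UNIV::'m set). b)" using assms by (intro sum_mono2) auto
    finally show ?thesis by simp
  qed
  hence "(\<Sum>i\<in>UNIV. \<Sum>k\<in>UNIV - {i}. a i k) \<le> (\<Sum>i\<in>(UNIV::'m set). real CARD('m) * b)"
    by (intro sum_mono) auto
  thus ?thesis by (simp add: power2_eq_square)
qed

text \<open>One pair with a very negative value must be able to pull the whole sum down. Its entry
  is replaced by 0, which is still at most \<open>b\<close>, and its own bound \<open>l\<close> is
  added separately.\<close>

lemma off_diagonal_sum_le_special:
  fixes a :: "'m::finite \<Rightarrow> 'm \<Rightarrow> real"
  assumes "\<And>i k. i \<noteq> k \<Longrightarrow> a i k \<le> b" "0 \<le> b" and pq: "p \<noteq> q" "a p q \<le> l"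
  shows "(\<Sum>i\<in>UNIV. \<Sum>k\<in>UNIV - {i}. a i k) \<le> (real CARD('m))\<^sup>2 * b + l"
proof -
  define a' where "a' i k = (if i = p \<and> k = q then 0 else a i k)" for i k
  have "(\<Sum>i\<in>UNIV. \<Sum>k\<in>UNIV - {i}. a i k)
      = (\<Sum>i\<in>UNIV. \<Sum>k\<in>UNIV - {i}. a' i k + (if i = p \<and> k = q then a p q else 0))"
    by (intro sum.cong refl) (auto simp: a'_def)
  also have "\<dots> = (\<Sum>i\<in>UNIV. \<Sum>k\<in>UNIV - {i}. a' i k)
      + (\<Sum>i\<in>UNIV. \<Sum>k\<in>UNIV - {i}. if i = p \<and> k = q then a p q else 0)"
    by (simp add: sum.distrib)
  also have "(\<Sum>i\<in>UNIV. \<Sum>k\<in>UNIV - {i}. if i = p \<and> k = q then a p q else 0)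
      = (\<Sum>i\<in>UNIV. if i = p then a p q else 0)"
  proof (intro sum.cong refl)
    fix i
    show "(\<Sum>k\<in>UNIV - {i}. if i = p \<and> k = q then a p q else 0) = (if i = p then a p q else 0)"
      using pq by (cases "i = p") (auto simp: sum.delta)
  qed
  also have "\<dots> = a p q" by simp
  also have "(\<Sum>i\<in>UNIV. \<Sum>k\<in>UNIV - {i}. a' i k) \<le> (real CARD('m))\<^sup>2 * b"
    using assms by (intro off_diagonal_sum_le) (auto simp: a'_def)
  finally show ?thesis using pq by simp
qed

lemma inner_row_diff_le:
  fixes X :: "real^'m^'m"
  shows "(X $ i - X $ k) \<bullet> (X $ i - X $ k) \<le> 4 * (X \<bullet> X)"
proof -
  have "norm (X $ i - X $ k) \<le> 2 * norm X"
    using norm_triangle_ineq4[of "X $ i" "X $ k"] Finite_Cartesian_Product.norm_nth_le[of X i]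
      Finite_Cartesian_Product.norm_nth_le[of X k] by linarith
  hence "(norm (X $ i - X $ k))\<^sup>2 \<le> (2 * norm X)\<^sup>2" by (intro power_mono) auto
  thus ?thesis by (simp add: power2_norm_eq_inner power_mult_distrib)
qed

text \<open>The cutoff only raises the logarithms and hence lowers the initial energy; the resulting
  bound does not contain \<open>\<delta>\<close>.\<close>

lemma cutoff_energy_le:
  fixes H B V :: "real^'m^'m"
  assumes "0 < \<delta>" "B \<in> distinct_rows"
  shows "cutoff_energy \<delta> H B V \<le> V \<bullet> V - 1/2 * (\<Sum>i\<in>UNIV. \<Sum>k\<in>UNIV - {i}.
     ln ((B $ i - B $ k) \<bullet> (B $ i - B $ k)) - H $ i $ k * ((B $ i - B $ k) \<bullet> (B $ i - B $ k)))"
proof -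
  have "ln ((B $ i - B $ k) \<bullet> (B $ i - B $ k)) \<le> cutoff_ln \<delta> ((B $ i - B $ k) \<bullet> (B $ i - B $ k))"
    if "i \<noteq> k" for i k
    using assms that by (intro ln_le_cutoff_ln) (auto simp: distinct_rows_def inner_gt_zero_iff)
  thus ?thesis unfolding cutoff_energy_def
    by (intro diff_left_mono mult_left_mono sum_mono diff_right_mono) auto
qed

text \<open>The quantifier order matters: \<open>\<delta>\<close> is fixed from \<open>H\<close>,
  \<open>B\<close>, \<open>V\<close> and \<open>T\<close> before any solution is considered, since
  the modified system itself depends on \<open>\<delta>\<close>.\<close>

lemma cutoff_solution_separated:
  fixes H B V :: "real^'m^'m"
  assumes sym: "\<And>i k. H $ i $ k = H $ k $ i" and nonneg: "\<And>i k. 0 \<le> H $ i $ k"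
    and B: "B \<in> distinct_rows"
  obtains \<delta> where "0 < \<delta>"
    and "\<And>X Y t i k. \<lbrakk>\<And>t. (X has_vector_derivative Y t) (at t);
        \<And>t. (Y has_vector_derivative cutoff_force \<delta> H (X t)) (at t);
        X t\<^sub>0 = B; Y t\<^sub>0 = V; \<bar>t - t\<^sub>0\<bar> \<le> T; i \<noteq> k\<rbrakk>
      \<Longrightarrow> \<delta> \<le> (norm (X t $ i - X t $ k))\<^sup>2"
proof -
  define e where "e = \<bar>V \<bullet> V - 1/2 * (\<Sum>i\<in>UNIV. \<Sum>k\<in>UNIV - {i}.
     ln ((B $ i - B $ k) \<bullet> (B $ i - B $ k)) - H $ i $ k * ((B $ i - B $ k) \<bullet> (B $ i - B $ k)))\<bar>"
  define N where "N = (real CARD('m))\<^sup>2"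
  \<comment> \<open>The rate comes from \<open>2 * \<bar>X \<bullet> Y\<bar> \<le> X \<bullet> X + Y
    \<bullet> Y\<close> together with
    \<open>Y \<bullet> Y \<le> e + 2 * N * (X \<bullet> X)\<close>.\<close>
  define c where "c = 1 + 2 * N"
  define R where "R = (B \<bullet> B + e) * exp (c * T)"
  \<comment> \<open>With this choice a close pair forces \<open>Y \<bullet> Y \<le> e + 1/2 * (4 * N
    * R + ln \<delta>) = - 1/2\<close>.\<close>
  define \<delta> where "\<delta> = exp (- (2 * e + 4 * N * R + 1))"
  have pos: "0 \<le> e" "0 \<le> N" "1 \<le> c" "0 \<le> R"
    by (auto simp: e_def N_def c_def R_def)
  hence "0 \<le> 4 * N * R" by simp
  have "\<delta> \<le> exp 0"
    unfolding \<delta>_def exp_le_cancel_iff using pos(1) \<open>0 \<le> 4 * N * R\<close> by linarith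
  hence \<delta>: "0 < \<delta>" "\<delta> \<le> 1" by (simp_all add: \<delta>_def)
  have "\<delta> \<le> (norm (X t $ i - X t $ k))\<^sup>2"
    if X: "\<And>t. (X has_vector_derivative Y t) (at t)"
      and Y: "\<And>t. (Y has_vector_derivative cutoff_force \<delta> H (X t)) (at t)"
      and init: "X t\<^sub>0 = B" "Y t\<^sub>0 = V" and t: "\<bar>t - t\<^sub>0\<bar> \<le> T" and "i \<noteq> k" for X Y t i k
  proof (rule ccontr)
    assume close: "\<not> \<delta> \<le> (norm (X t $ i - X t $ k))\<^sup>2"
    define w where "w t i k = cutoff_ln \<delta> ((X t $ i - X t $ k) \<bullet> (X t $ i - X t $ k))
      - H $ i $ k * ((X t $ i - X t $ k) \<bullet> (X t $ i - X t $ k))" for t i k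
    have w_le_ln: "w t i k \<le> cutoff_ln \<delta> ((X t $ i - X t $ k) \<bullet> (X t $ i - X t $ k))" for t i k
      using nonneg[of i k] by (simp add: w_def)
    have w_le: "w t i k \<le> 4 * (X t \<bullet> X t)" for t i k
      using w_le_ln[of t i k] cutoff_ln_le_self[OF \<delta>, of "(X t $ i - X t $ k) \<bullet> (X t $ i - X t $ k)"]
        inner_row_diff_le[of "X t" i k] by simp
    have YY: "Y t \<bullet> Y t \<le> e + 1/2 * (\<Sum>i\<in>UNIV. \<Sum>k\<in>UNIV - {i}. w t i k)" for t
      using cutoff_energy_conserved[OF \<delta>(1) sym X Y, of t t\<^sub>0] cutoff_energy_le[OF \<delta>(1) B, of H V]
      unfolding init by (simp add: cutoff_energy_def w_def e_def)
    \<comment> \<open>Adding \<open>e\<close> to the squared norm makes the differential inequality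
      homogeneous, as \<open>1 \<le> c\<close>.\<close>
    have "X t \<bullet> X t + e \<le> (X t\<^sub>0 \<bullet> X t\<^sub>0 + e) * exp (c * \<bar>t - t\<^sub>0\<bar>)"
    proof (rule gronwall_abs[where I = UNIV and u = "\<lambda>t. X t \<bullet> X t + e"])
      fix s
      show "((\<lambda>t. X t \<bullet> X t + e) has_real_derivative 2 * (X s \<bullet> Y s)) (at s)"
        using DERIV_add[OF has_real_derivative_inner[OF X X] DERIV_const[of e]]
        by (simp add: inner_commute)
      have "\<bar>2 * (X s \<bullet> Y s)\<bar> \<le> X s \<bullet> X s + Y s \<bullet> Y s"
        using inner_ge_zero[of "X s - Y s"] inner_ge_zero[of "X s + Y s"]
        by (simp add: inner_diff_left inner_diff_right inner_add_left inner_add_right inner_commute)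
      also have "Y s \<bullet> Y s \<le> e + 1/2 * (N * (4 * (X s \<bullet> X s)))"
        unfolding N_def using YY[of s] off_diagonal_sum_le[where a = "w s", OF w_le] inner_ge_zero[of "X s"]
        by linarith
      also have "X s \<bullet> X s + (e + 1/2 * (N * (4 * (X s \<bullet> X s)))) \<le> c * (X s \<bullet> X s) + 1 * e"
        by (simp add: c_def algebra_simps)
      also have "\<dots> \<le> c * (X s \<bullet> X s) + c * e" using pos by (intro add_left_mono mult_right_mono)
      finally show "\<bar>2 * (X s \<bullet> Y s)\<bar> \<le> c * (X s \<bullet> X s + e)" by (simp add: algebra_simps)
    qed auto
    also have "\<dots> \<le> R" unfolding R_def init using t pos by (intro mult_left_mono) auto
    finally have XX: "X t \<bullet> X t \<le> R" using pos by simp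
    have "w t i k \<le> ln \<delta>"
      using close cutoff_ln_le[OF \<delta>(1), of "(norm (X t $ i - X t $ k))\<^sup>2"]
      by (intro order_trans[OF w_le_ln]) (simp add: power2_norm_eq_inner)
    moreover have "w t p q \<le> 4 * R" for p q
      using w_le[of t p q] XX by linarith
    ultimately have "(\<Sum>i\<in>UNIV. \<Sum>k\<in>UNIV - {i}. w t i k) \<le> N * (4 * R) + ln \<delta>"
      unfolding N_def using pos \<open>i \<noteq> k\<close>
      by (intro off_diagonal_sum_le_special[where p = i and q = k]) auto
    also have "ln \<delta> = - (2 * e + 4 * N * R + 1)" by (simp add: \<delta>_def)
    finally have "Y t \<bullet> Y t < 0" using YY[of t] by simp
    thus False using inner_ge_zero[of "Y t"] by simp
  qed
  thus ?thesis using that[OF \<delta>(1)] by blast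
qed

text \<open>The modified system has a global solution, and within the time window its rows stay far
  enough apart that the cutoff is never active.\<close>

lemma solves_ivp_exists:
  fixes H B V :: "real^'m^'m"
  assumes "\<And>i k. H $ i $ k = H $ k $ i" "\<And>i k. 0 \<le> H $ i $ k"
    and "B \<in> distinct_rows" "0 < T"
  shows "\<exists>Z. solves_ivp H t\<^sub>0 B V {t\<^sub>0 - T<..<t\<^sub>0 + T} Z"
proof -
  obtain \<delta> where "0 < \<delta>"
    and sep: "\<And>X Y t i k. \<lbrakk>\<And>t. (X has_vector_derivative Y t) (at t);
        \<And>t. (Y has_vector_derivative cutoff_force \<delta> H (X t)) (at t);
        X t\<^sub>0 = B; Y t\<^sub>0 = V; \<bar>t - t\<^sub>0\<bar> \<le> T; i \<noteq> k\<rbrakk>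
      \<Longrightarrow> \<delta> \<le> (norm (X t $ i - X t $ k))\<^sup>2"
    using cutoff_solution_separated[OF assms(1-3), of t\<^sub>0 V T] by blast
  obtain Z where Z: "Z t\<^sub>0 = (B, V)" "\<And>t. (Z has_vector_derivative cutoff_field \<delta> H (Z t)) (at t)"
    using lipschitz_cutoff_field[OF \<open>0 < \<delta>\<close>, of H] lipschitz_ode_global_solution by metis
  have X: "((\<lambda>s. fst (Z s)) has_vector_derivative snd (Z t)) (at t)"
    and Y: "((\<lambda>s. snd (Z s)) has_vector_derivative cutoff_force \<delta> H (fst (Z t))) (at t)" for t
    using bounded_linear.has_vector_derivative[OF bounded_linear_fst Z(2)[of t]]
      bounded_linear.has_vector_derivative[OF bounded_linear_snd Z(2)[of t]]
    by (simp_all add: cutoff_field_def)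
  have "Z t \<in> distinct_rows \<times> UNIV
      \<and> ((\<lambda>s. snd (Z s)) has_vector_derivative force H (fst (Z t))) (at t)"
    if "t \<in> {t\<^sub>0 - T<..<t\<^sub>0 + T}" for t
  proof -
    have *: "\<delta> \<le> (norm (fst (Z t) $ i - fst (Z t) $ k))\<^sup>2" if "i \<noteq> k" for i k
      using \<open>t \<in> _\<close> that Z(1) by (intro sep[OF X Y]) auto
    have "fst (Z t) $ i \<noteq> fst (Z t) $ k" if "i \<noteq> k" for i k
      using *[OF that] \<open>0 < \<delta>\<close> by auto
    thus ?thesis using cutoff_force_eq_force[OF *] Y[of t] by (auto simp: distinct_rows_def mem_Times_iff)
  qed
  hence "solves_ivp H t\<^sub>0 B V {t\<^sub>0 - T<..<t\<^sub>0 + T} Z"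
    unfolding solves_ivp_def using X Z(1) \<open>0 < T\<close> by (auto simp: is_interval_oo)
  thus ?thesis by blast
qed

section \<open>Uniqueness and the maximal solution\<close>

lemma compact_rows_separated:
  fixes X :: "real \<Rightarrow> real^'m^'m"
  assumes "compact S" "continuous_on S X" "\<And>s. s \<in> S \<Longrightarrow> X s \<in> distinct_rows"
  obtains \<delta> where "0 < \<delta>" "\<And>s i k. s \<in> S \<Longrightarrow> i \<noteq> k \<Longrightarrow> \<delta> \<le> (norm (X s $ i - X s $ k))\<^sup>2"
proof -
  have "\<exists>\<delta>>0. \<forall>s\<in>S. i \<noteq> k \<longrightarrow> \<delta> \<le> (norm (X s $ i - X s $ k))\<^sup>2" for i k
  proof (cases "S = {} \<or> i = k")
    case True
    thus ?thesis by (auto intro: exI[of _ 1])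
  next
    case False
    have "continuous_on S (\<lambda>s. (norm (X s $ i - X s $ k))\<^sup>2)"
      using assms(2) by (intro continuous_intros)
    then obtain s where s: "s \<in> S" "\<forall>r\<in>S. (norm (X s $ i - X s $ k))\<^sup>2 \<le> (norm (X r $ i - X r $ k))\<^sup>2"
      using continuous_attains_inf[OF assms(1)] False by blast
    have "0 < (norm (X s $ i - X s $ k))\<^sup>2"
      using assms(3)[OF s(1)] False by (auto simp: distinct_rows_def)
    thus ?thesis using s by blast
  qed
  then obtain d where d: "\<And>i k. 0 < d i k"
    "\<And>i k s. s \<in> S \<Longrightarrow> i \<noteq> k \<Longrightarrow> d i k \<le> (norm (X s $ i - X s $ k))\<^sup>2"
    by metis
  \<comment> \<open>Each pair has a positive minimal distance on the compact set; finitely many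
    pairs leave a positive overall minimum.\<close>
  define \<delta> where "\<delta> = Min (range (case_prod d))"
  have "0 < \<delta>" using d(1) by (auto simp: \<delta>_def)
  moreover have "\<delta> \<le> d i k" for i k
    unfolding \<delta>_def by (rule Min_le) (auto intro: image_eqI[of _ _ "(i, k)"])
  ultimately show ?thesis using that[of \<delta>] d(2) order_trans by blast
qed

text \<open>The original force is singular at collisions and not globally Lipschitz. Between
  \<open>t\<^sub>0\<close> and \<open>t\<close>, however, both solutions keep their rows apart by
  compactness, so for small \<open>\<delta>\<close> both solve the same modified system, whose
  solutions are unique.\<close>

lemma solves_ivp_unique:
  fixes H B V :: "real^'m^'m"
  assumes sol: "solves_ivp H t\<^sub>0 B V I Z" "solves_ivp H t\<^sub>0 B V I' Z'" and t: "t \<in> I" "t \<in> I'"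
  shows "Z t = Z' t"
proof -
  define S where "S = closed_segment t\<^sub>0 t"
  have S: "compact S" "is_interval S" "t\<^sub>0 \<in> S" "t \<in> S"
    by (auto simp: S_def is_interval_convex_1)
  have sub: "S \<subseteq> J" if "solves_ivp H t\<^sub>0 B V J W" "t \<in> J" for J and W :: "real \<Rightarrow> _"
    using that closed_segment_subset[of t\<^sub>0 J t]
    by (simp add: S_def solves_ivp_def is_interval_convex_1)
  \<comment> \<open>The claim covers all smaller cutoffs as well, so that the two solutions can
    share the minimum of their thresholds.\<close>
  have field: "\<exists>d>0. \<forall>\<delta>. 0 < \<delta> \<and> \<delta> \<le> d \<longrightarrow>
      (\<forall>s\<in>S. (W has_vector_derivative cutoff_field \<delta> H (W s)) (at s))"
    if W: "solves_ivp H t\<^sub>0 B V J W" "t \<in> J" for J and W :: "real \<Rightarrow> _"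
  proof -
    have D: "((\<lambda>s. fst (W s)) has_vector_derivative snd (W s)) (at s)"
      "((\<lambda>s. snd (W s)) has_vector_derivative force H (fst (W s))) (at s)"
      "fst (W s) \<in> distinct_rows" if "s \<in> S" for s
      using W(1) sub[OF W] that by (auto simp: solves_ivp_def mem_Times_iff)
    have "continuous_on S (\<lambda>s. fst (W s))"
      using D(1) by (intro continuous_at_imp_continuous_on ballI has_vector_derivative_continuous)
    then obtain d where d: "0 < d"
      "\<And>s i k. s \<in> S \<Longrightarrow> i \<noteq> k \<Longrightarrow> d \<le> (norm (fst (W s) $ i - fst (W s) $ k))\<^sup>2"
      using compact_rows_separated[of S "\<lambda>s. fst (W s)"] S(1) D(3) by blast
    have "(W has_vector_derivative cutoff_field \<delta> H (W s)) (at s)" if "\<delta> \<le> d" "s \<in> S" for \<delta> s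
    proof -
      have "cutoff_force \<delta> H (fst (W s)) = force H (fst (W s))"
        using d(2)[OF that(2)] that(1) by (intro cutoff_force_eq_force) (meson order_trans)
      thus ?thesis
        using has_vector_derivative_Pair[OF D(1,2)[OF that(2)]] by (simp add: cutoff_field_def)
    qed
    thus ?thesis using d(1) by blast
  qed
  obtain d where d: "0 < d" "\<forall>\<delta>. 0 < \<delta> \<and> \<delta> \<le> d \<longrightarrow>
      (\<forall>s\<in>S. (Z has_vector_derivative cutoff_field \<delta> H (Z s)) (at s))"
    using field[OF sol(1) t(1)] by (elim exE conjE)
  obtain d' where d': "0 < d'" "\<forall>\<delta>. 0 < \<delta> \<and> \<delta> \<le> d' \<longrightarrow>
      (\<forall>s\<in>S. (Z' has_vector_derivative cutoff_field \<delta> H (Z' s)) (at s))"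
    using field[OF sol(2) t(2)] by (elim exE conjE)
  define \<delta> where "\<delta> = min d d'"
  have \<delta>: "0 < \<delta>" "\<delta> \<le> d" "\<delta> \<le> d'" using d(1) d'(1) by (auto simp: \<delta>_def)
  obtain L where L: "L-lipschitz_on UNIV (cutoff_field \<delta> H)"
    using lipschitz_cutoff_field[OF \<delta>(1)] by metis
  show ?thesis
  proof (rule lipschitz_ode_unique[OF L S(2-4)])
    show "Z t\<^sub>0 = Z' t\<^sub>0" using sol by (simp add: solves_ivp_def)
  qed (use d(2) d'(2) \<delta> in simp_all)
qed

text \<open>Uniqueness makes the definite description in \<open>maximal_solution\<close>
  well-defined.\<close>

lemma maximal_solution_eq:
  assumes "solves_ivp H t\<^sub>0 B V I Z" "t \<in> I"
  shows "maximal_solution H t\<^sub>0 B V t = Z t"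
  unfolding maximal_solution_def
proof (rule the_equality)
  show "\<exists>I Z'. solves_ivp H t\<^sub>0 B V I Z' \<and> t \<in> I \<and> Z t = Z' t"
    using assms by (intro exI conjI) auto
  show "z = Z t" if "\<exists>I Z'. solves_ivp H t\<^sub>0 B V I Z' \<and> t \<in> I \<and> z = Z' t" for z
    using that solves_ivp_unique[OF assms(1) _ assms(2)] by metis
qed

theorem theorem3:
  fixes E :: "'m::finite set set" and H B V :: "real^'m^'m" and t\<^sub>0 :: real
  assumes "simple_graph E" and "H = adjacency_matrix E"
    and "B \<in> distinct_rows"
  shows "existence_interval H t\<^sub>0 B V = UNIV \<and>
    solves_ivp H t\<^sub>0 B V (existence_interval H t\<^sub>0 B V) (maximal_solution H t\<^sub>0 B V)"
proof -
  have H: "H $ i $ k = H $ k $ i" "0 \<le> H $ i $ k" for i k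
    using assms(2) by (auto simp: adjacency_matrix_def insert_commute)
  have local: "\<exists>I Z. solves_ivp H t\<^sub>0 B V I Z \<and> t \<in> I" for t
  proof -
    \<comment> \<open>The added 1 puts \<open>t\<close> strictly inside the open window and keeps
      \<open>T\<close> positive when \<open>t = t\<^sub>0\<close>.\<close>
    define T where "T = \<bar>t - t\<^sub>0\<bar> + 1"
    have "0 < T" "t \<in> {t\<^sub>0 - T<..<t\<^sub>0 + T}" by (auto simp: T_def)
    thus ?thesis using solves_ivp_exists[OF H assms(3)] by metis
  qed
  have all: "existence_interval H t\<^sub>0 B V = UNIV"
    using local by (auto simp: existence_interval_def)
  let ?Z = "maximal_solution H t\<^sub>0 B V"
  have "?Z t \<in> distinct_rows \<times> UNIV
      \<and> ((\<lambda>s. fst (?Z s)) has_vector_derivative snd (?Z t)) (at t)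
      \<and> ((\<lambda>s. snd (?Z s)) has_vector_derivative force H (fst (?Z t))) (at t)" for t
  proof -
    \<comment> \<open>Near \<open>t\<close> the maximal solution coincides with a solution on an
      open interval, and derivatives depend only on values near \<open>t\<close>.\<close>
    obtain I Z where Z: "solves_ivp H t\<^sub>0 B V I Z" "t \<in> I" using local by blast
    note eq = maximal_solution_eq[OF Z(1)]
    have "open I" "Z t \<in> distinct_rows \<times> UNIV"
      "((\<lambda>s. fst (Z s)) has_vector_derivative snd (?Z t)) (at t)"
      "((\<lambda>s. snd (Z s)) has_vector_derivative force H (fst (?Z t))) (at t)"
      using Z eq[OF Z(2)] by (auto simp: solves_ivp_def)
    thus ?thesis
      using eq Z(2) by (auto intro: has_vector_derivative_transform_within_open[of _ _ _ I])
  qed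
  moreover have "?Z t\<^sub>0 = (B, V)"
    using local[of t\<^sub>0] maximal_solution_eq by (metis solves_ivp_def)
  ultimately show ?thesis unfolding all by (simp add: solves_ivp_def)
qed

end
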